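(* Assume that the functions $f_1,\dots,f_n:\mathbb{R}^d\to\mathbb{R}$ are differentiable. Let $\mathbf{x}^\star\in\arg\min_{\mathbf{x}\in\mathbb{R}^d}F(\mathbf{x})$ be such that $f_i(\mathbf{x}^\star)=f_j(\mathbf{x}^\star)$ for all indices $i,j$. Assume further that $\nabla f_i(\mathbf{x}^\star)\neq0$ for at least one index $i$. Then there exist non-zero values $o_i$ such that $\bar o:=\frac1n\sum_{i=1}^n o_i=0$ and the function $\hat L_\lambda(\mathbf{x})$ defined as $$\hat L_\lambda(\mathbf{x}):=\hat F(\mathbf{x})+\frac{\lambda}{2n}\sum_{i=1}^n\big(\hat f_i(\mathbf{x})-\hat F(\mathbf{x})\big)^2,$$ where $\hat f_i(\mathbf{x})=f_i(\mathbf{x})+o_i$ and $\hat F(\mathbf{x})=F(\mathbf{x})=\frac1n\sum_{i=1}^n\hat f_i(\mathbf{x})$, has a different stationary point than $F(\mathbf{x})$.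
   Context: $n$ is the number of clients, $f_i$ is the local loss function of client $i$, and $F(\mathbf{x})=\frac1n\sum_{i=1}^n f_i(\mathbf{x})$ is the average loss. $\lambda$ is a tunable regularization parameter controlling the degree of fairness (setting it to zero removes the variance term). A stationary point of a differentiable function is a point where its gradient vanishes.
   Formalization: The parameter λ is assumed non-zero (for λ = 0 the two functions coincide), and "has a different stationary point" is taken to mean that x* is stationary for F but not for L̂_λ, since L̂_λ may have no stationary point at all. *)

theory Defs
  imports "HOL-Analysis.Analysis"
begin

text \<open>
  The library offers the gradient only as a relation (\<^const>\<open>gderiv\<close>, written \<open>GDERIV f x :> D\<close>);
  \<open>grad\<close> is the corresponding function. It is meaningful only where \<open>f\<close> is differentiable.
\<close>

definition grad :: "('a::euclidean_space \<Rightarrow> real) \<Rightarrow> 'a \<Rightarrow> 'a" where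
  "grad f x = (THE D. GDERIV f x :> D)"

definition stationary_point :: "('a::euclidean_space \<Rightarrow> real) \<Rightarrow> 'a \<Rightarrow> bool" where
  "stationary_point f x \<longleftrightarrow> f differentiable (at x) \<and> grad f x = 0"

definition avg_loss :: "nat \<Rightarrow> (nat \<Rightarrow> 'a \<Rightarrow> real) \<Rightarrow> 'a \<Rightarrow> real" where
  "avg_loss n f x = (1 / real n) * (\<Sum>i=1..n. f i x)"

definition fair_loss :: "nat \<Rightarrow> real \<Rightarrow> (nat \<Rightarrow> 'a \<Rightarrow> real) \<Rightarrow> 'a \<Rightarrow> real" where
  "fair_loss n lam f x =
     avg_loss n f x + (lam / (2 * real n)) * (\<Sum>i=1..n. (f i x - avg_loss n f x)\<^sup>2)"

definition shifted :: "(nat \<Rightarrow> 'a \<Rightarrow> real) \<Rightarrow> (nat \<Rightarrow> real) \<Rightarrow> nat \<Rightarrow> 'a \<Rightarrow> real" where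
  "shifted f c i x = f i x + c i"

lemma grad_eqI:
  fixes f :: "'a::euclidean_space \<Rightarrow> real"
  assumes "GDERIV f x :> D"
  shows "grad f x = D"
proof -
  have unique: "E = D" if "GDERIV f x :> E" for E
  proof -
    have "(\<lambda>h. h \<bullet> E) = (\<lambda>h. h \<bullet> D)"
      using that assms unfolding gderiv_def by (rule has_derivative_unique)
    then have "\<forall>h. h \<bullet> E = h \<bullet> D"
      by (auto dest: fun_cong)
    then show "E = D"
      by (simp only: vector_eq_ldot)
  qed
  show ?thesis
    unfolding grad_def using assms unique by (rule the_equality)
qed

lemma differentiable_imp_GDERIV_grad:
  fixes f :: "'a::euclidean_space \<Rightarrow> real"
  assumes "f differentiable (at x)"
  shows "GDERIV f x :> grad f x"
proof -
  obtain f' where f': "(f has_derivative f') (at x)"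
    using assms unfolding differentiable_def by blast
  then interpret bounded_linear f'
    by (rule has_derivative_bounded_linear)
  define D where "D = (\<Sum>b\<in>Basis. f' b *\<^sub>R b)"
  have "f' h = h \<bullet> D" for h
  proof -
    have "f' h = f' (\<Sum>b\<in>Basis. (h \<bullet> b) *\<^sub>R b)"
      by (simp add: euclidean_representation)
    also have "\<dots> = (\<Sum>b\<in>Basis. (h \<bullet> b) * f' b)"
      by (simp only: sum scaleR real_scaleR_def)
    also have "\<dots> = h \<bullet> D"
      unfolding D_def inner_sum_right by (rule sum.cong) simp_all
    finally show ?thesis .
  qed
  then have "f' = (\<lambda>h. h \<bullet> D)"
    by (rule ext)
  with f' have "GDERIV f x :> D"
    unfolding gderiv_def by simp
  moreover from this have "grad f x = D"
    by (rule grad_eqI)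
  ultimately show ?thesis
    by (simp only:)
qed

lemma avg_loss_differentiable:
  fixes f :: "nat \<Rightarrow> 'a::euclidean_space \<Rightarrow> real"
  assumes "\<And>i. i \<in> {1..n} \<Longrightarrow> f i differentiable (at x)"
  shows "avg_loss n f differentiable (at x)"
proof -
  have "(\<lambda>y. \<Sum>i=1..n. f i y) differentiable (at x)"
    using assms by (intro differentiable_sum) simp_all
  then have "(\<lambda>y. (1 / real n) * (\<Sum>i=1..n. f i y)) differentiable (at x)"
    by (intro differentiable_mult differentiable_const)
  then show ?thesis
    by (simp only: avg_loss_def [abs_def])
qed

lemma fair_loss_differentiable:
  fixes f :: "nat \<Rightarrow> 'a::euclidean_space \<Rightarrow> real"
  assumes "\<And>i. i \<in> {1..n} \<Longrightarrow> f i differentiable (at x)"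
  shows "fair_loss n lam f differentiable (at x)"
proof -
  have avg: "avg_loss n f differentiable (at x)"
    using assms by (rule avg_loss_differentiable)
  then have "(\<lambda>y. \<Sum>i=1..n. (f i y - avg_loss n f y)\<^sup>2) differentiable (at x)"
    using assms by (intro differentiable_sum differentiable_power differentiable_diff) simp_all
  then have "(\<lambda>y. (lam / (2 * real n)) * (\<Sum>i=1..n. (f i y - avg_loss n f y)\<^sup>2))
      differentiable (at x)"
    by (intro differentiable_mult differentiable_const)
  with avg have "(\<lambda>y. avg_loss n f y +
      (lam / (2 * real n)) * (\<Sum>i=1..n. (f i y - avg_loss n f y)\<^sup>2)) differentiable (at x)"
    by (intro differentiable_add)
  then show ?thesis
    by (simp only: fair_loss_def [abs_def])
qed

lemma shifted_differentiable:
  fixes f :: "nat \<Rightarrow> 'a::euclidean_space \<Rightarrow> real"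
  assumes "f i differentiable (at x)"
  shows "shifted f c i differentiable (at x)"
  unfolding shifted_def [abs_def] using assms
  by (intro differentiable_add differentiable_const)

end

theory Submission
  imports Defs
begin

text \<open>
  With \<open>g\<^sub>i = \<nabla>f\<^sub>i(x\<^sup>\<star>)\<close>, the minimality of \<open>x\<^sup>\<star>\<close> gives \<open>\<Sum>\<^sub>i g\<^sub>i = 0\<close>,
  and since the losses agree at \<open>x\<^sup>\<star>\<close> the gradient of the shifted fair loss there is \<open>(\<lambda>/n) \<Sum>\<^sub>i c\<^sub>i g\<^sub>i\<close>. If \<open>g\<^sub>k \<noteq> 0\<close>, the offsets
  \<open>c\<^sub>k = 1 - n\<close> and \<open>c\<^sub>i = 1\<close> for \<open>i \<noteq> k\<close> make it \<open>-\<lambda> g\<^sub>k \<noteq> 0\<close>; they are non-zero because \<open>n = 1\<close>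
  would force \<open>g\<^sub>k = 0\<close>.
\<close>

lemma has_derivative_avg_loss:
  fixes f :: "nat \<Rightarrow> 'a::real_inner \<Rightarrow> real"
  assumes "\<And>i. i \<in> {1..n} \<Longrightarrow> GDERIV (f i) x :> G i"
  shows "(avg_loss n f has_derivative (\<lambda>h. h \<bullet> ((1 / real n) *\<^sub>R (\<Sum>i=1..n. G i)))) (at x)"
proof -
  have "((\<lambda>y. (1 / real n) * (\<Sum>i=1..n. f i y)) has_derivative
      (\<lambda>h. (1 / real n) * (\<Sum>i=1..n. h \<bullet> G i))) (at x)"
    using assms unfolding gderiv_def by (intro has_derivative_mult_right has_derivative_sum)
  then show ?thesis
    by (simp add: avg_loss_def [abs_def] inner_sum_right)
qed

text \<open>As the \<open>G i\<close> sum to zero, the average has derivative zero at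
  \<open>x\<close>. Its own summand thus drops out, and each square contributes only its deviation
  times \<open>G i\<close>; the 2 from the square cancels the one in
  \<open>lam / (2 * real n)\<close>.\<close>

lemma GDERIV_fair_loss:
  fixes f :: "nat \<Rightarrow> 'a::real_inner \<Rightarrow> real"
  assumes G: "\<And>i. i \<in> {1..n} \<Longrightarrow> GDERIV (f i) x :> G i"
    and stationary: "(\<Sum>i=1..n. G i) = 0"
  shows "GDERIV (fair_loss n lam f) x :>
    (lam / real n) *\<^sub>R (\<Sum>i=1..n. (f i x - avg_loss n f x) *\<^sub>R G i)"
proof -
  have avg: "(avg_loss n f has_derivative (\<lambda>h. 0)) (at x)"
    using has_derivative_avg_loss [of n f x G, OF G] by (simp only: stationary) simp
  have "((\<lambda>y. (f i y - avg_loss n f y)\<^sup>2) has_derivative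
      (\<lambda>h. 2 * (f i x - avg_loss n f x) * (h \<bullet> G i))) (at x)" if "i \<in> {1..n}" for i
  proof -
    have "((\<lambda>y. f i y - avg_loss n f y) has_derivative (\<lambda>h. h \<bullet> G i - 0)) (at x)"
      using G [OF that] avg unfolding gderiv_def by (rule has_derivative_diff)
    from has_derivative_power [OF this, of 2] show ?thesis
      by (simp add: mult_ac del: right_diff_distrib_numeral left_diff_distrib_numeral)
  qed
  then have "((\<lambda>y. \<Sum>i=1..n. (f i y - avg_loss n f y)\<^sup>2) has_derivative
      (\<lambda>h. \<Sum>i=1..n. 2 * (f i x - avg_loss n f x) * (h \<bullet> G i))) (at x)"
    by (rule has_derivative_sum)
  then have "(fair_loss n lam f has_derivative
      (\<lambda>h. 0 + (lam / (2 * real n)) * (\<Sum>i=1..n. 2 * (f i x - avg_loss n f x) * (h \<bullet> G i)))) (at x)"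
    unfolding fair_loss_def [abs_def] by (intro has_derivative_add avg has_derivative_mult_right)
  moreover have "0 + (lam / (2 * real n)) * (\<Sum>i=1..n. 2 * (f i x - avg_loss n f x) * (h \<bullet> G i)) =
      h \<bullet> ((lam / real n) *\<^sub>R (\<Sum>i=1..n. (f i x - avg_loss n f x) *\<^sub>R G i))" for h
    unfolding inner_scaleR_right inner_sum_right add_0_left sum_distrib_left
    by (rule sum.cong) (simp_all add: mult.assoc del: right_diff_distrib_numeral)
  ultimately show ?thesis
    unfolding gderiv_def by (simp only:)
qed

lemma avg_loss_shifted:
  assumes "(\<Sum>i=1..n. c i) = 0"
  shows "avg_loss n (shifted f c) = avg_loss n f"
  using assms by (simp add: avg_loss_def [abs_def] shifted_def sum.distrib)

theorem theorem4:
  fixes f :: "nat \<Rightarrow> real ^ 'd \<Rightarrow> real"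
    and n :: nat
    and lam :: real
    and xs :: "real ^ 'd"
  assumes diff: "\<forall>i\<in>{1..n}. \<forall>x. f i differentiable (at x)"
    and lam: "lam \<noteq> 0"
    and argmin: "is_arg_min (avg_loss n f) (\<lambda>x. True) xs"
    and equal: "\<forall>i\<in>{1..n}. \<forall>j\<in>{1..n}. f i xs = f j xs"
    and nonzero: "\<exists>i\<in>{1..n}. grad (f i) xs \<noteq> 0"
  shows "\<exists>c :: nat \<Rightarrow> real.
      (\<forall>i\<in>{1..n}. c i \<noteq> 0) \<and>
      (1 / real n) * (\<Sum>i=1..n. c i) = 0 \<and>
      avg_loss n (shifted f c) = avg_loss n f \<and>
      stationary_point (avg_loss n f) xs \<and>
      \<not> stationary_point (fair_loss n lam (shifted f c)) xs"
proof -
  define G where "G i = grad (f i) xs" for i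
  have G: "GDERIV (f i) xs :> G i" if "i \<in> {1..n}" for i
    unfolding G_def using diff that by (intro differentiable_imp_GDERIV_grad) blast
  from nonzero obtain k where k: "k \<in> {1..n}" "G k \<noteq> 0"
    unfolding G_def by blast
  then have n: "real n \<noteq> 0" by simp

  have avg_deriv: "(avg_loss n f has_derivative (\<lambda>h. h \<bullet> ((1 / real n) *\<^sub>R (\<Sum>i=1..n. G i)))) (at xs)"
    using G by (rule has_derivative_avg_loss)
  have "avg_loss n f xs \<le> avg_loss n f y" for y
    using argmin by (simp add: is_arg_min_linorder)
  then have "\<forall>\<^sub>F y in at xs. avg_loss n f xs \<le> avg_loss n f y"
    by (rule always_eventually [OF allI])
  with avg_deriv have "(\<lambda>h. h \<bullet> ((1 / real n) *\<^sub>R (\<Sum>i=1..n. G i))) = (\<lambda>h. 0)"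
    by (rule has_derivative_local_min)
  \<comment> \<open>Evaluating the vanishing derivative at the gradient itself gives the squared
    norm of that gradient, so the gradient is zero.\<close>
  from fun_cong [OF this, of "(1 / real n) *\<^sub>R (\<Sum>i=1..n. G i)"]
  have sum_G: "(\<Sum>i=1..n. G i) = 0"
    using n by (simp only: inner_eq_zero_iff) simp
  \<comment> \<open>For \<open>n = 1\<close> the vanishing sum would consist of \<open>G k\<close>
    alone.\<close>
  have "n \<noteq> 1"
    using sum_G k by auto

  have f_xs: "f i xs = avg_loss n f xs" if "i \<in> {1..n}" for i
  proof -
    have "(\<Sum>j=1..n. f j xs) = (\<Sum>j=1..n. f i xs)"
      using equal that by (intro sum.cong refl) blast
    then show ?thesis
      using n by (simp add: avg_loss_def)
  qed

  \<comment> \<open>Writing \<open>c\<close> as the constant 1 minus a multiple of the indicator of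
    \<open>k\<close> lets the sums of \<open>c i\<close> and of \<open>c i *\<^sub>R G i\<close>
    split: the constant part of the latter is \<open>sum_G\<close>, and the indicator keeps only the
    term at \<open>k\<close>.\<close>
  define c where "c i = 1 - (if i = k then real n else 0)" for i
  have c_nonzero: "\<forall>i\<in>{1..n}. c i \<noteq> 0"
    using \<open>n \<noteq> 1\<close> by (simp add: c_def)
  have sum_c: "(\<Sum>i=1..n. c i) = 0"
    using k by (simp add: c_def sum_subtractf)
  have "(\<Sum>i=1..n. c i *\<^sub>R G i) = (\<Sum>i=1..n. G i - (if i = k then real n *\<^sub>R G i else 0))"
    by (intro sum.cong) (auto simp: c_def scaleR_diff_left)
  also have "\<dots> = - (real n *\<^sub>R G k)"
    using k sum_G by (simp add: sum_subtractf)
  finally have sum_cG: "(\<Sum>i=1..n. c i *\<^sub>R G i) = - (real n *\<^sub>R G k)" .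
  note avg_shifted = avg_loss_shifted [where f = f, OF sum_c]

  \<comment> \<open>Constant offsets leave the gradients unchanged, so \<open>sum_G\<close> serves
    the shifted losses too.\<close>
  have "GDERIV (shifted f c i) xs :> G i" if "i \<in> {1..n}" for i
    using has_derivative_add [OF G [OF that, unfolded gderiv_def] has_derivative_const [of "c i"]]
    by (simp add: gderiv_def shifted_def [abs_def])
  from GDERIV_fair_loss [OF this sum_G, of lam]
  have "GDERIV (fair_loss n lam (shifted f c)) xs :> (lam / real n) *\<^sub>R (\<Sum>i=1..n. c i *\<^sub>R G i)"
    \<comment> \<open>The average is unshifted and equals every \<open>f i xs\<close>, so the
      deviation of the shifted loss at \<open>xs\<close> is exactly \<open>c i\<close>.\<close>
    by (simp add: avg_shifted f_xs shifted_def)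
  from grad_eqI [OF this] have "grad (fair_loss n lam (shifted f c)) xs = - (lam *\<^sub>R G k)"
    using n by (simp add: sum_cG del: One_nat_def)
  then have not_stationary: "\<not> stationary_point (fair_loss n lam (shifted f c)) xs"
    using lam k by (simp add: stationary_point_def)

  have "GDERIV (avg_loss n f) xs :> 0"
    using avg_deriv by (simp add: gderiv_def sum_G del: One_nat_def)
  moreover have "avg_loss n f differentiable (at xs)"
    using avg_deriv by (rule differentiableI)
  ultimately have "stationary_point (avg_loss n f) xs"
    by (simp add: stationary_point_def grad_eqI)
  with c_nonzero sum_c avg_shifted not_stationary show ?thesis
    by (intro exI [of _ c]) simp
qed

end
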